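(* Let $\mathbf{H}\in\mathbb{R}^{V\times V}$ be a graph filter. Then $\mathbf{H}$ is a polynomial filter of $\mathbf{S}_1,\ldots,\mathbf{S}_d$ if and only if the matrix $\mathbf{U}^T\mathbf{H}\mathbf{U}$ is the same for all orthogonal matrices $\mathbf{U}$ satisfying $\mathbf{S}_l=\mathbf{U}\boldsymbol{\Lambda}_l\mathbf{U}^T$ for all $1\le l\le d$, where the diagonal matrices $\boldsymbol{\Lambda}_1,\ldots,\boldsymbol{\Lambda}_d$ of the simultaneous eigendecomposition are fixed.
   Context: Let $\mathcal{G}=(V,E,\mathbf{W})$ be a finite, simple, undirected graph with $N\ge 2$ vertices. A graph filter is a real matrix in $\mathbb{R}^{V\times V}$. A graph shift is a matrix $\mathbf{S}=[s(i,j)]_{i,j\in V}$ with $s(i,j)=0$ unless $i=j$ or $(i,j)\in E$. Standing assumption: $\mathbf{S}_1,\ldots,\mathbf{S}_d$ are graph shifts that are real-valued, symmetric and pairwise commuting; hence there are an orthogonal matrix $\mathbf{U}=[\mathbf{u}_1,\ldots,\mathbf{u}_N]$ and diagonal matrices $\boldsymbol{\Lambda}_l=\mathrm{diag}[\lambda_l(1),\ldots,\lambda_l(N)]$ such that $\mathbf{S}_l=\mathbf{U}\boldsymbol{\Lambda}_l\mathbf{U}^T$ for all $1\le l\le d$. A polynomial filter is a matrix of the form $h(\mathbf{S}_1,\ldots,\mathbf{S}_d)$ for some real multivariate polynomial $h(t_1,\ldots,t_d)$. *)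

theory Defs
  imports
    "HOL-Analysis.Analysis"
    "HOL-Library.Poly_Mapping"
    "Graph_Theory.Pair_Digraph"
begin

text \<open>
  Finite simple undirected graphs are the symmetric loopfree digraphs of \<^locale>\<open>pair_graph\<close>.
  The vertex set is the whole finite type \<^typ>\<open>'v\<close>, so that real matrices indexed by vertices have
  type \<^typ>\<open>real^'v^'v\<close>. The weights are symmetric and vanish off the edges; nothing else
  (such as positivity) is required of them.
\<close>

locale weighted_graph = pair_graph G
  for G :: "'v::finite pair_pre_digraph" +
  fixes W :: "real^'v^'v"
  assumes verts_UNIV: "pverts G = UNIV"
    and weights_sym: "transpose W = W"
    and weights_edges: "W $ i $ j \<noteq> 0 \<Longrightarrow> (i, j) \<in> parcs G"

definition graph_shift :: "'v::finite pair_pre_digraph \<Rightarrow> real^'v^'v \<Rightarrow> bool" where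
  "graph_shift G A \<longleftrightarrow> (\<forall>i j. i \<noteq> j \<and> (i, j) \<notin> parcs G \<longrightarrow> A $ i $ j = 0)"

definition diag_matrix :: "('n::finite \<Rightarrow> real) \<Rightarrow> real^'n^'n" where
  "diag_matrix a = (\<chi> i j. if i = j then a i else 0)"

definition matrix_power :: "real^'n^'n \<Rightarrow> nat \<Rightarrow> real^'n^'n" where
  "matrix_power A k = (((**) A) ^^ k) (mat 1)"

text \<open>
  A real polynomial in the variables \<open>t\<^sub>1, \<dots>, t\<^sub>d\<close> is a finitely supported family of coefficients
  indexed by monomials, and a monomial is a finitely supported family of exponents indexed by
  variables.
\<close>

type_synonym real_mpoly = "(nat \<Rightarrow>\<^sub>0 nat) \<Rightarrow>\<^sub>0 real"

definition mpoly_in_vars :: "nat \<Rightarrow> real_mpoly \<Rightarrow> bool" where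
  "mpoly_in_vars d h \<longleftrightarrow> (\<forall>m \<in> Poly_Mapping.keys h. Poly_Mapping.keys m \<subseteq> {1..d})"

text \<open>
  The factors of a monomial are multiplied in the order \<open>S\<^sub>1\<close>, \dots, \<open>S\<^sub>d\<close>; the order is
  immaterial when the matrices commute.
\<close>

definition eval_monomial :: "nat \<Rightarrow> (nat \<Rightarrow> real^'n^'n) \<Rightarrow> (nat \<Rightarrow>\<^sub>0 nat) \<Rightarrow> real^'n^'n" where
  "eval_monomial d S m =
     foldr (**) (map (\<lambda>l. matrix_power (S l) (Poly_Mapping.lookup m l)) [1..<Suc d]) (mat 1)"

definition eval_mpoly :: "nat \<Rightarrow> (nat \<Rightarrow> real^'n^'n) \<Rightarrow> real_mpoly \<Rightarrow> real^'n^'n" where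
  "eval_mpoly d S h =
     (\<Sum>m \<in> Poly_Mapping.keys h. Poly_Mapping.lookup h m *\<^sub>R eval_monomial d S m)"

definition polynomial_filter :: "nat \<Rightarrow> (nat \<Rightarrow> real^'n^'n) \<Rightarrow> real^'n^'n \<Rightarrow> bool" where
  "polynomial_filter d S H \<longleftrightarrow> (\<exists>h. mpoly_in_vars d h \<and> H = eval_mpoly d S h)"

text \<open>
  The columns of \<open>U\<close> are the common eigenvectors; columns and eigenvalues are
  indexed by the same finite type as the vertices.
\<close>

definition simult_eigendecomp ::
  "nat \<Rightarrow> (nat \<Rightarrow> real^'n^'n) \<Rightarrow> (nat \<Rightarrow> 'n::finite \<Rightarrow> real) \<Rightarrow> real^'n^'n \<Rightarrow> bool" where
  "simult_eigendecomp d S ev U \<longleftrightarrow>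
     orthogonal_matrix U \<and>
     (\<forall>l \<in> {1..d}. S l = U ** diag_matrix (ev l) ** transpose U)"

end

theory Submission
  imports Defs
begin

text \<open>
  If \<open>U\<close> is one simultaneous eigenbasis, the others are \<open>U V\<close> with \<open>V\<close> orthogonal and commuting with
  every \<open>\<Lambda>\<^sub>l\<close>, so invariance means that \<open>M = U\<^sup>T H U\<close> commutes with all such \<open>V\<close>. Sign changes of a
  single coordinate force \<open>M\<close> to be diagonal, and transpositions of two coordinates with the same
  joint eigenvalues force the diagonal entries to be a function of the joint eigenvalues. By
  multivariate Lagrange interpolation such a function is a polynomial.
\<close>

section \<open>Polynomial functions and interpolation\<close>

definition monomial_value :: "nat \<Rightarrow> (nat \<Rightarrow>\<^sub>0 nat) \<Rightarrow> (nat \<Rightarrow> real) \<Rightarrow> real" where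
  "monomial_value d m y = (\<Prod>l = 1..d. y l ^ Poly_Mapping.lookup m l)"

definition mpoly_value :: "nat \<Rightarrow> real_mpoly \<Rightarrow> (nat \<Rightarrow> real) \<Rightarrow> real" where
  "mpoly_value d h y = (\<Sum>m \<in> Poly_Mapping.keys h. Poly_Mapping.lookup h m * monomial_value d m y)"

text \<open>Sets of functions suffice because only values at the joint eigenvalues matter later;
  closure proofs may then choose any representing polynomial.\<close>

definition mpoly_functions :: "nat \<Rightarrow> ((nat \<Rightarrow> real) \<Rightarrow> real) set" where
  "mpoly_functions d = mpoly_value d ` Collect (mpoly_in_vars d)"

section \<open>Closure properties of polynomial functions\<close>

lemma monomial_value_add:
  "monomial_value d (m + n) y = monomial_value d m y * monomial_value d n y"
  by (simp add: monomial_value_def lookup_add power_add prod.distrib)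

text \<open>Coefficients off the support are zero. A common index set is needed since cancellation
  can make the keys of \<open>h + k\<close> a proper subset of the union.\<close>

lemma mpoly_value_superset:
  assumes "finite A" "Poly_Mapping.keys h \<subseteq> A"
  shows "mpoly_value d h y = (\<Sum>m \<in> A. Poly_Mapping.lookup h m * monomial_value d m y)"
  unfolding mpoly_value_def using assms
  by (intro sum.mono_neutral_left) (auto simp: in_keys_iff)

lemma mpoly_value_add: "mpoly_value d (h + k) y = mpoly_value d h y + mpoly_value d k y"
proof -
  let ?A = "Poly_Mapping.keys h \<union> Poly_Mapping.keys k"
  have "Poly_Mapping.keys (h + k) \<subseteq> ?A"
    by (rule keys_add)
  then show ?thesis
    by (simp add: mpoly_value_superset[of ?A] lookup_add distrib_right sum.distrib)
qed

lemma mpoly_functions_monomial: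
  assumes "Poly_Mapping.keys m \<subseteq> {1..d}"
  shows "(\<lambda>y. c * monomial_value d m y) \<in> mpoly_functions d"
proof -
  \<comment> \<open>Summing over \<open>{m}\<close> also covers \<open>c = 0\<close>, where the
    polynomial has no keys.\<close>
  have "mpoly_value d (Poly_Mapping.single m c) = (\<lambda>y. c * monomial_value d m y)"
    by (rule ext) (simp add: mpoly_value_superset[of "{m}"])
  moreover have "mpoly_in_vars d (Poly_Mapping.single m c)"
    using assms by (simp add: mpoly_in_vars_def)
  ultimately show ?thesis
    unfolding mpoly_functions_def by force
qed

lemma mpoly_functions_const: "(\<lambda>_. c) \<in> mpoly_functions d"
  using mpoly_functions_monomial[of 0 d c] by (simp add: monomial_value_def)

lemma mpoly_functions_coordinate:
  assumes "l \<in> {1..d}"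
  shows "(\<lambda>y. y l) \<in> mpoly_functions d"
proof -
  have "monomial_value d (Poly_Mapping.single l 1) y = y l" for y
  proof -
    have "monomial_value d (Poly_Mapping.single l 1) y = (\<Prod>k = 1..d. if k = l then y k else 1)"
      unfolding monomial_value_def by (intro prod.cong) (auto simp: lookup_single when_def)
    then show ?thesis
      using assms by simp
  qed
  then show ?thesis
    using mpoly_functions_monomial[of "Poly_Mapping.single l 1" d 1] assms by simp
qed

lemma mpoly_functions_add:
  assumes "f \<in> mpoly_functions d" "g \<in> mpoly_functions d"
  shows "(\<lambda>y. f y + g y) \<in> mpoly_functions d"
proof -
  obtain h k where h: "mpoly_in_vars d h" "f = mpoly_value d h"
    and k: "mpoly_in_vars d k" "g = mpoly_value d k"
    using assms unfolding mpoly_functions_def by auto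
  have "mpoly_in_vars d (h + k)"
    using h(1) k(1) keys_add[of h k] unfolding mpoly_in_vars_def by blast
  moreover have "(\<lambda>y. f y + g y) = mpoly_value d (h + k)"
    by (simp add: h k mpoly_value_add fun_eq_iff)
  ultimately show ?thesis
    unfolding mpoly_functions_def by auto
qed

lemma mpoly_functions_sum:
  assumes "finite I" "\<And>i. i \<in> I \<Longrightarrow> f i \<in> mpoly_functions d"
  shows "(\<lambda>y. \<Sum>i\<in>I. f i y) \<in> mpoly_functions d"
  using assms by (induction I rule: finite_induct)
    (simp_all add: mpoly_functions_const mpoly_functions_add)

lemma mpoly_functions_mult:
  assumes "f \<in> mpoly_functions d" "g \<in> mpoly_functions d"
  shows "(\<lambda>y. f y * g y) \<in> mpoly_functions d"
proof -
  obtain h k where h: "mpoly_in_vars d h" "f = mpoly_value d h"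
    and k: "mpoly_in_vars d k" "g = mpoly_value d k"
    using assms unfolding mpoly_functions_def by auto
  \<comment> \<open>Exponents add when monomials multiply, so expanding gives a finite sum of
    monomial functions; the product polynomial of \<open>h\<close> and \<open>k\<close> is never
    formed.\<close>
  have "(\<lambda>y. f y * g y) = (\<lambda>y. \<Sum>m \<in> Poly_Mapping.keys h. \<Sum>n \<in> Poly_Mapping.keys k.
      (Poly_Mapping.lookup h m * Poly_Mapping.lookup k n) * monomial_value d (m + n) y)"
    by (simp add: h k mpoly_value_def sum_product monomial_value_add mult_ac)
  also have "\<dots> \<in> mpoly_functions d"
  proof (intro mpoly_functions_sum mpoly_functions_monomial finite_keys)
    fix m n assume "m \<in> Poly_Mapping.keys h" "n \<in> Poly_Mapping.keys k"
    then show "Poly_Mapping.keys (m + n) \<subseteq> {1..d}"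
      using h(1) k(1) keys_add[of m n] unfolding mpoly_in_vars_def by blast
  qed
  finally show ?thesis .
qed

lemma mpoly_functions_prod:
  assumes "finite I" "\<And>i. i \<in> I \<Longrightarrow> f i \<in> mpoly_functions d"
  shows "(\<lambda>y. \<Prod>i\<in>I. f i y) \<in> mpoly_functions d"
  using assms by (induction I rule: finite_induct)
    (simp_all add: mpoly_functions_const mpoly_functions_mult)

text \<open>Supplies one factor of a Lagrange basis function. Points are functions on all naturals,
  so \<open>a\<close> and \<open>b\<close> stand for their classes modulo agreement on
  \<open>{1..d}\<close>.\<close>

lemma mpoly_functions_separating:
  assumes "\<exists>l\<in>{1..d}. a l \<noteq> b l"
  shows "\<exists>p\<in>mpoly_functions d. (\<forall>y. (\<forall>l\<in>{1..d}. y l = a l) \<longrightarrow> p y = 1) \<and>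
    (\<forall>y. (\<forall>l\<in>{1..d}. y l = b l) \<longrightarrow> p y = 0)"
proof -
  obtain l where l: "l \<in> {1..d}" "a l \<noteq> b l"
    using assms by blast
  \<comment> \<open>The affine function of one distinguishing coordinate that sends
    \<open>a l\<close> to 1 and \<open>b l\<close> to 0.\<close>
  have "(\<lambda>y. (1 / (a l - b l)) * (y l + (- b l))) \<in> mpoly_functions d"
    by (intro mpoly_functions_mult mpoly_functions_add mpoly_functions_const
        mpoly_functions_coordinate l)
  then show ?thesis
    by (rule bexI[rotated]) (use l in auto)
qed

text \<open>
  The points \<open>x i\<close> may coincide, so the Lagrange basis function of a point occurs once for each index
  of that point; dividing by their number compensates for this.
\<close>

lemma mpoly_interpolation:
  fixes x :: "'a::finite \<Rightarrow> nat \<Rightarrow> real" and g :: "'a \<Rightarrow> real"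
  assumes g: "\<And>i j. (\<forall>l\<in>{1..d}. x i l = x j l) \<Longrightarrow> g i = g j"
  shows "\<exists>p\<in>mpoly_functions d. \<forall>i. p (x i) = g i"
proof -
  define eq where "eq i j \<longleftrightarrow> (\<forall>l\<in>{1..d}. x j l = x i l)" for i j
  have "\<exists>p\<in>mpoly_functions d. (\<forall>k. eq i k \<longrightarrow> p (x k) = 1) \<and> (\<forall>k. eq j k \<longrightarrow> p (x k) = 0)"
    if "\<not> eq i j" for i j
    using mpoly_functions_separating[of d "x i" "x j"] that unfolding eq_def by fastforce
  then obtain q where q: "\<And>i j. \<not> eq i j \<Longrightarrow> q i j \<in> mpoly_functions d"
    and q1: "\<And>i j k. \<not> eq i j \<Longrightarrow> eq i k \<Longrightarrow> q i j (x k) = 1"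
    and q0: "\<And>i j k. \<not> eq i j \<Longrightarrow> eq j k \<Longrightarrow> q i j (x k) = 0"
    by metis
  \<comment> \<open>One factor for each index in another class makes \<open>L i\<close> the
    indicator of the class of \<open>i\<close> on the given points.\<close>
  define L where "L i y = (\<Prod>j | \<not> eq i j. q i j y)" for i y
  have L: "L i (x k) = (if eq i k then 1 else 0)" for i k
  proof (cases "eq i k")
    case True
    then show ?thesis
      by (simp add: L_def q1)
  next
    case False
    \<comment> \<open>The factor with \<open>j = k\<close> occurs in the product and kills
      it.\<close>
    moreover have "q i k (x k) = 0"
      using False by (intro q0) (auto simp: eq_def)
    ultimately show ?thesis
      unfolding L_def by (simp add: prod_zero_iff) blast
  qed
  have eq_sym: "eq i k \<longleftrightarrow> eq k i" for i k
    by (auto simp: eq_def)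
  define p where "p y = (\<Sum>i\<in>UNIV. g i / card {j. eq i j} * L i y)" for y
  have "p \<in> mpoly_functions d"
    unfolding p_def L_def
    by (intro mpoly_functions_sum mpoly_functions_mult mpoly_functions_const
        mpoly_functions_prod q) auto
  moreover have "p (x k) = g k" for k
  proof -
    have "p (x k) = (\<Sum>i\<in>UNIV. if eq k i then g i / card {j. eq i j} else 0)"
      unfolding p_def by (intro sum.cong) (auto simp: L eq_sym)
    also have "\<dots> = (\<Sum>i | eq k i. g i / card {j. eq i j})"
      by (simp add: sum.If_cases)
    \<comment> \<open>Both \<open>g\<close> and the class size are constant on the class of
      \<open>k\<close>, so the sum is that many copies of one term; the class contains
      \<open>k\<close>, hence its size cancels.\<close>
    also have "\<dots> = (\<Sum>i | eq k i. g k / card {j. eq k j})"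
    proof (intro sum.cong refl)
      fix i assume "i \<in> {i. eq k i}"
      then have "g i = g k" "{j. eq i j} = {j. eq k j}"
        using g[of i k] by (auto simp: eq_def)
      then show "g i / card {j. eq i j} = g k / card {j. eq k j}"
        by simp
    qed
    also have "\<dots> = g k"
    proof -
      have "k \<in> {j. eq k j}"
        by (simp add: eq_def)
      then have "card {j. eq k j} \<noteq> 0"
        by (metis card_0_eq empty_iff finite)
      then show ?thesis
        by simp
    qed
    finally show ?thesis .
  qed
  ultimately show ?thesis
    by blast
qed

section \<open>Diagonalised matrices\<close>

lemma matrix_mult_diag_nth: "(A ** diag_matrix a) $ i $ j = A $ i $ j * a j"
  by (simp add: matrix_matrix_mult_def diag_matrix_def if_distrib cong: if_cong)

lemma diag_mult_matrix_nth: "(diag_matrix a ** A) $ i $ j = a i * A $ i $ j"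
  by (simp add: matrix_matrix_mult_def diag_matrix_def if_distrib[of "\<lambda>c. c * _"] cong: if_cong)

lemma diag_matrix_mult: "diag_matrix a ** diag_matrix b = diag_matrix (\<lambda>i. a i * b i)"
  by (simp add: vec_eq_iff matrix_mult_diag_nth) (simp add: diag_matrix_def)

lemma diag_matrix_one: "diag_matrix (\<lambda>_. 1) = mat 1"
  by (simp add: diag_matrix_def mat_def)

lemma transpose_diag_matrix: "transpose (diag_matrix a) = diag_matrix a"
  by (simp add: vec_eq_iff transpose_def diag_matrix_def)

lemma orthogonal_conjugate_cancel:
  fixes U A :: "real^'n^'n"
  assumes "orthogonal_matrix U"
  shows "transpose U ** (U ** A ** transpose U) ** U = A"
    and "U ** (transpose U ** A ** U) ** transpose U = A"
proof -
  have U: "transpose U ** U = mat 1" "U ** transpose U = mat 1"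
    using assms by (auto simp: orthogonal_matrix_def)
  have "transpose U ** (U ** A ** transpose U) ** U = (transpose U ** U) ** A ** (transpose U ** U)"
    by (simp only: matrix_mul_assoc)
  then show "transpose U ** (U ** A ** transpose U) ** U = A"
    by (simp add: U)
  have "U ** (transpose U ** A ** U) ** transpose U = (U ** transpose U) ** A ** (U ** transpose U)"
    by (simp only: matrix_mul_assoc)
  then show "U ** (transpose U ** A ** U) ** transpose U = A"
    by (simp add: U)
qed

text \<open>The inner \<open>transpose U ** U\<close> cancels, so matrix products become entrywise
  products of eigenvalues.\<close>

lemma orthogonal_diag_mult:
  fixes U :: "real^'n^'n"
  assumes "orthogonal_matrix U"
  shows "(U ** diag_matrix a ** transpose U) ** (U ** diag_matrix b ** transpose U) =
    U ** diag_matrix (\<lambda>i. a i * b i) ** transpose U"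
proof -
  have "(U ** diag_matrix a ** transpose U) ** (U ** diag_matrix b ** transpose U) =
    U ** (diag_matrix a ** (transpose U ** U) ** diag_matrix b) ** transpose U"
    by (simp only: matrix_mul_assoc)
  also have "transpose U ** U = mat 1"
    using assms by (simp add: orthogonal_matrix_def)
  finally show ?thesis
    by (simp add: diag_matrix_mult)
qed

lemma orthogonal_diag_one:
  fixes U :: "real^'n^'n"
  assumes "orthogonal_matrix U"
  shows "U ** diag_matrix (\<lambda>_. 1) ** transpose U = mat 1"
  using assms by (simp add: diag_matrix_one orthogonal_matrix_def)

section \<open>Polynomials in simultaneously diagonalised matrices\<close>

lemma matrix_power_orthogonal_diag:
  fixes U :: "real^'n^'n"
  assumes "orthogonal_matrix U"
  shows "matrix_power (U ** diag_matrix a ** transpose U) k =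
    U ** diag_matrix (\<lambda>i. a i ^ k) ** transpose U"
  by (induction k)
    (simp_all add: matrix_power_def orthogonal_diag_one orthogonal_diag_mult assms)

lemma eval_monomial_eigendecomp:
  assumes "simult_eigendecomp d S ev U"
  shows "eval_monomial d S m =
    U ** diag_matrix (\<lambda>i. monomial_value d m (\<lambda>l. ev l i)) ** transpose U"
proof -
  have U: "orthogonal_matrix U"
    and S: "\<And>l. l \<in> {1..d} \<Longrightarrow> S l = U ** diag_matrix (ev l) ** transpose U"
    using assms by (auto simp: simult_eigendecomp_def)
  \<comment> \<open>Generalised from \<open>[1..<Suc d]\<close> to any list of valid indices, so
    that induction on the list applies.\<close>
  have "foldr (**) (map (\<lambda>l. matrix_power (S l) (Poly_Mapping.lookup m l)) ls) (mat 1) =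
      U ** diag_matrix (\<lambda>i. prod_list (map (\<lambda>l. ev l i ^ Poly_Mapping.lookup m l) ls)) ** transpose U"
    if "set ls \<subseteq> {1..d}" for ls
    using that
  proof (induction ls)
    case Nil
    then show ?case
      by (simp add: orthogonal_diag_one[OF U])
  next
    case (Cons l ls)
    then have "S l = U ** diag_matrix (ev l) ** transpose U"
      by (intro S) simp
    then show ?case
      using Cons by (simp add: matrix_power_orthogonal_diag[OF U] orthogonal_diag_mult[OF U])
  qed
  \<comment> \<open>The list is distinct with set \<open>{1..d}\<close>, so the list product is the
    set product in \<open>monomial_value\<close>.\<close>
  from this[of "[1..<Suc d]"] show ?thesis
    by (simp add: eval_monomial_def monomial_value_def prod.distinct_set_conv_list[symmetric]
        atLeastLessThanSuc_atLeastAtMost del: upt_Suc)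
qed

lemma linear_matrix_conjugate:
  fixes U :: "real^'n^'n"
  shows "linear (\<lambda>A. U ** A ** transpose U)"
proof (rule linearI)
  show "U ** (A + B) ** transpose U = U ** A ** transpose U + U ** B ** transpose U" for A B
    by (simp add: vec_eq_iff matrix_matrix_mult_def distrib_left distrib_right sum.distrib)
  show "U ** (c *\<^sub>R A) ** transpose U = c *\<^sub>R (U ** A ** transpose U)" for c A
    by (simp only: matrix_scalar_ac scalar_matrix_assoc)
qed

lemma eval_mpoly_eigendecomp:
  assumes "simult_eigendecomp d S ev U"
  shows "eval_mpoly d S h = U ** diag_matrix (\<lambda>i. mpoly_value d h (\<lambda>l. ev l i)) ** transpose U"
proof -
  have "diag_matrix (\<lambda>i. mpoly_value d h (\<lambda>l. ev l i)) =
    (\<Sum>m\<in>Poly_Mapping.keys h. Poly_Mapping.lookup h m *\<^sub>R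
      diag_matrix (\<lambda>i. monomial_value d m (\<lambda>l. ev l i)))"
    by (simp add: vec_eq_iff diag_matrix_def mpoly_value_def)
  then show ?thesis
    unfolding eval_mpoly_def eval_monomial_eigendecomp[OF assms]
    by (simp only: linear_sum[OF linear_matrix_conjugate] linear_cmul[OF linear_matrix_conjugate])
qed

text \<open>Conjugation by \<open>U\<close> is invertible, so the question becomes one about
  functions on the joint eigenvalues, where interpolation applies.\<close>

lemma polynomial_filter_iff_mpoly_function:
  assumes "simult_eigendecomp d S ev U"
  shows "polynomial_filter d S H \<longleftrightarrow>
    (\<exists>p\<in>mpoly_functions d. transpose U ** H ** U = diag_matrix (\<lambda>i. p (\<lambda>l. ev l i)))"
proof -
  have U: "orthogonal_matrix U"
    using assms by (simp add: simult_eigendecomp_def)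
  have "H = U ** D ** transpose U \<longleftrightarrow> transpose U ** H ** U = D" for D
    using orthogonal_conjugate_cancel[OF U] by metis
  then show ?thesis
    by (auto simp: polynomial_filter_def mpoly_functions_def eval_mpoly_eigendecomp[OF assms])
qed

section \<open>Changing the eigenbasis\<close>

text \<open>Commutation moves \<open>V\<close> past each diagonal factor, where it meets
  \<open>transpose V\<close> and cancels.\<close>

lemma simult_eigendecomp_change_basis:
  assumes "simult_eigendecomp d S ev U" and V: "orthogonal_matrix V"
    and comm: "\<And>l. l \<in> {1..d} \<Longrightarrow> V ** diag_matrix (ev l) = diag_matrix (ev l) ** V"
  shows "simult_eigendecomp d S ev (U ** V)"
proof -
  have U: "orthogonal_matrix U"
    and S: "\<And>l. l \<in> {1..d} \<Longrightarrow> S l = U ** diag_matrix (ev l) ** transpose U"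
    using assms(1) by (auto simp: simult_eigendecomp_def)
  have "U ** V ** diag_matrix (ev l) ** transpose (U ** V) = S l" if "l \<in> {1..d}" for l
  proof -
    have "U ** V ** diag_matrix (ev l) ** transpose (U ** V) =
      U ** (V ** diag_matrix (ev l)) ** transpose V ** transpose U"
      by (simp only: matrix_transpose_mul matrix_mul_assoc)
    also have "\<dots> = U ** diag_matrix (ev l) ** (V ** transpose V) ** transpose U"
      by (simp only: comm[OF that] matrix_mul_assoc)
    also have "\<dots> = S l"
      using V S[OF that] by (simp add: orthogonal_matrix_def)
    finally show ?thesis .
  qed
  then show ?thesis
    using orthogonal_matrix_mul[OF U V] by (simp add: simult_eigendecomp_def)
qed

text \<open>Multiplying the invariance equation by \<open>V\<close> on the left cancels the
  \<open>transpose V\<close> on its right-hand side.\<close>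

lemma invariant_commutes:
  fixes U V H :: "real^'n^'n"
  assumes "orthogonal_matrix V" "transpose U ** H ** U = transpose (U ** V) ** H ** (U ** V)"
  shows "V ** (transpose U ** H ** U) = (transpose U ** H ** U) ** V"
proof -
  have "V ** (transpose U ** H ** U) = (V ** transpose V) ** transpose U ** H ** U ** V"
    by (subst assms(2)) (simp only: matrix_transpose_mul matrix_mul_assoc)
  then show ?thesis
    using assms(1) by (simp add: orthogonal_matrix_def matrix_mul_assoc)
qed

section \<open>Permutation matrices of involutions\<close>

definition perm_matrix :: "('n \<Rightarrow> 'n) \<Rightarrow> real^'n^'n::finite" where
  "perm_matrix s = (\<chi> i j. if j = s i then 1 else 0)"

lemma perm_matrix_mult_nth: "(perm_matrix s ** A) $ i $ j = A $ s i $ j"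
  by (simp add: perm_matrix_def matrix_matrix_mult_def if_distrib[of "\<lambda>c. c * _"] cong: if_cong)

text \<open>Right multiplication moves columns by the inverse permutation, which for an involution
  is \<open>s\<close> itself.\<close>

lemma matrix_mult_perm_nth:
  assumes "\<And>i. s (s i) = i"
  shows "(A ** perm_matrix s) $ i $ j = A $ i $ s j"
proof -
  have "j = s k \<longleftrightarrow> k = s j" for k
    using assms by metis
  then show ?thesis
    by (simp add: perm_matrix_def matrix_matrix_mult_def if_distrib cong: if_cong)
qed

text \<open>For an involution the matrix is symmetric and squares to the identity.\<close>

lemma orthogonal_perm_matrix:
  assumes "\<And>i. s (s i) = i"
  shows "orthogonal_matrix (perm_matrix s)"
proof -
  have "j = s k \<longleftrightarrow> k = s j" for j k
    using assms by metis
  then have "transpose (perm_matrix s) = perm_matrix s"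
    by (simp add: vec_eq_iff transpose_def perm_matrix_def)
  moreover have "perm_matrix s ** perm_matrix s = mat 1"
    by (simp add: vec_eq_iff perm_matrix_mult_nth) (simp add: perm_matrix_def mat_def assms eq_commute)
  ultimately show ?thesis
    by (simp add: orthogonal_matrix_def)
qed

theorem theorem2p9:
  fixes G :: "'v::finite pair_pre_digraph"
    and W :: "real^'v^'v"
    and d :: nat
    and S :: "nat \<Rightarrow> real^'v^'v"
    and ev :: "nat \<Rightarrow> 'v \<Rightarrow> real"
    and H :: "real^'v^'v"
  assumes "weighted_graph G W"
    and "CARD('v) \<ge> 2"
    and "\<And>l. l \<in> {1..d} \<Longrightarrow> graph_shift G (S l)"
    and "\<And>l. l \<in> {1..d} \<Longrightarrow> transpose (S l) = S l"
    and "\<And>k l. k \<in> {1..d} \<Longrightarrow> l \<in> {1..d} \<Longrightarrow> S k ** S l = S l ** S k"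
    and "\<exists>U. simult_eigendecomp d S ev U"
  shows "polynomial_filter d S H \<longleftrightarrow>
    (\<forall>U U'. simult_eigendecomp d S ev U \<and> simult_eigendecomp d S ev U' \<longrightarrow>
       transpose U ** H ** U = transpose U' ** H ** U')"
proof -
  obtain U where U: "simult_eigendecomp d S ev U"
    using assms(6) by blast
  show ?thesis
  proof
    assume "polynomial_filter d S H"
    then obtain h where h: "H = eval_mpoly d S h"
      by (auto simp: polynomial_filter_def)
    \<comment> \<open>The right-hand side depends only on \<open>h\<close> and the fixed
      eigenvalues, not on the eigenbasis.\<close>
    have "transpose U ** H ** U = diag_matrix (\<lambda>i. mpoly_value d h (\<lambda>l. ev l i))"
      if "simult_eigendecomp d S ev U" for U
    proof -
      have "orthogonal_matrix U"
        using that by (simp add: simult_eigendecomp_def)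
      then show ?thesis
        unfolding h eval_mpoly_eigendecomp[OF that] by (rule orthogonal_conjugate_cancel)
    qed
    then show "\<forall>U U'. simult_eigendecomp d S ev U \<and> simult_eigendecomp d S ev U' \<longrightarrow>
       transpose U ** H ** U = transpose U' ** H ** U'"
      by simp
  next
    assume inv: "\<forall>U U'. simult_eigendecomp d S ev U \<and> simult_eigendecomp d S ev U' \<longrightarrow>
       transpose U ** H ** U = transpose U' ** H ** U'"
    define M where "M = transpose U ** H ** U"
    have commutes: "V ** M = M ** V"
      if "orthogonal_matrix V"
        and "\<And>l. l \<in> {1..d} \<Longrightarrow> V ** diag_matrix (ev l) = diag_matrix (ev l) ** V" for V
      unfolding M_def
      using inv U simult_eigendecomp_change_basis[OF U that] that(1)
      by (intro invariant_commutes) blast+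
    have off_diagonal: "M $ i $ j = 0" if "i \<noteq> j" for i j
    proof -
      define V where "V = diag_matrix (\<lambda>k. if k = i then -1 else (1::real))"
      have "V ** V = mat 1"
        unfolding V_def diag_matrix_mult diag_matrix_one[symmetric]
        by (rule arg_cong[of _ _ diag_matrix]) auto
      then have "orthogonal_matrix V"
        by (simp add: orthogonal_matrix_def V_def transpose_diag_matrix)
      moreover have "V ** diag_matrix a = diag_matrix a ** V" for a
        by (simp add: V_def diag_matrix_mult mult.commute)
      \<comment> \<open>The left side is \<open>- M $ i $ j\<close> and, as \<open>j\<close> differs
        from \<open>i\<close>, the right side is \<open>M $ i $ j\<close>.\<close>
      ultimately have "(V ** M) $ i $ j = (M ** V) $ i $ j"
        using commutes by simp
      then show ?thesis
        using that by (simp add: V_def matrix_mult_diag_nth diag_mult_matrix_nth)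
    qed
    have diagonal: "M $ i $ i = M $ j $ j" if ij: "\<forall>l\<in>{1..d}. ev l i = ev l j" for i j
    proof -
      define s where "s = Transposition.transpose i j"
      have s: "s (s k) = k" for k
        by (simp add: s_def)
      have "perm_matrix s ** diag_matrix (ev l) = diag_matrix (ev l) ** perm_matrix s"
        if "l \<in> {1..d}" for l
      proof -
        \<comment> \<open>Swapping two indices with equal joint eigenvalues preserves every
          \<open>ev l\<close>; this is what makes the permutation matrix commute with the diagonal
          ones.\<close>
        have "ev l (s k) = ev l k" for k
          using ij that by (auto simp: s_def Transposition.transpose_def)
        then show ?thesis
          by (auto simp: vec_eq_iff matrix_mult_diag_nth diag_mult_matrix_nth perm_matrix_def)
      qed
      \<comment> \<open>At position \<open>(i, j)\<close> the row swap yields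
        \<open>M $ j $ j\<close> and the column swap yields \<open>M $ i $ i\<close>.\<close>
      then have "(perm_matrix s ** M) $ i $ j = (M ** perm_matrix s) $ i $ j"
        using commutes orthogonal_perm_matrix[of s] s by simp
      then show ?thesis
        by (simp add: perm_matrix_mult_nth matrix_mult_perm_nth[of s] s) (simp add: s_def)
    qed
    \<comment> \<open>The interpolation points are the joint eigenvalues, possibly repeated;
      \<open>diagonal\<close> says that the prescribed values are consistent.\<close>
    obtain p where p: "p \<in> mpoly_functions d" "\<And>i. p (\<lambda>l. ev l i) = M $ i $ i"
      using mpoly_interpolation[of d "\<lambda>i l. ev l i" "\<lambda>i. M $ i $ i"] diagonal by blast
    have "M = diag_matrix (\<lambda>i. p (\<lambda>l. ev l i))"
      by (simp add: vec_eq_iff diag_matrix_def off_diagonal p(2))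
    then show "polynomial_filter d S H"
      unfolding polynomial_filter_iff_mpoly_function[OF U] M_def[symmetric] using p(1) ..
  qed
qed

end
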